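(* The graph of trees $G_{10}$ is not planar.
   Context: For an even $n$ the graph of trees $G_n$ is defined as follows. The vertices of $G_n$ are the isomorphism classes (as abstract graphs) of trees with $n$ vertices. Two vertices of $G_n$ are adjacent if a transposition transforms one of the corresponding trees into the other, i.e. if some plane rooted versions of the two trees are related by one transposition. A plane rooted tree (pr-tree) is a rooted tree in which the children of every vertex are linearly ordered from left to right. The walk around it starts at the root and traverses each edge twice, once in each direction, visiting the children of each vertex from left to right (depth-first). Transposition: let $A,B,C$ be three vertices of a pr-tree such that $B$ has degree one and the walk meets vertices consecutively in the sequence $A,B,A,C$. The transposition moves the vertex $B$ with its attached edge along the single edge $AC$ from $A$ to $C$. Explicitly, $B$ is a childless child of $A$, and: (i) if $C$ is the child of $A$ immediately following $B$, then $B$ is removed from $A$ and becomes the first child of $C$; (ii) if $B$ is the last child of $A$ and $C$ is the parent of $A$, then $B$ is removed from $A$ and becomes a child of $C$ placed immediately after $A$. On the level of abstract trees, a transposition thus detaches a leaf $B$ from its neighbor $A$ and reattaches it to a vertex $C\neq B$ adjacent to $A$. *)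

theory Defs
  imports "HOL-Analysis.Analysis"
begin

section \<open>Simple graphs, trees and isomorphism\<close>

record 'a ugraph =
  verts :: "'a set"
  edges :: "'a set set"

definition simple_graph :: "'a ugraph \<Rightarrow> bool" where
  "simple_graph G \<longleftrightarrow> finite (verts G) \<and>
     (\<forall>e\<in>edges G. \<exists>u v. e = {u, v} \<and> u \<noteq> v \<and> u \<in> verts G \<and> v \<in> verts G)"

definition adjacent :: "'a ugraph \<Rightarrow> 'a \<Rightarrow> 'a \<Rightarrow> bool" where
  "adjacent G u v \<longleftrightarrow> {u, v} \<in> edges G"

definition connected_graph :: "'a ugraph \<Rightarrow> bool" where
  "connected_graph G \<longleftrightarrow> verts G \<noteq> {} \<and>
     (\<forall>u\<in>verts G. \<forall>v\<in>verts G. (adjacent G)\<^sup>*\<^sup>* u v)"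

definition graph_cycle :: "'a ugraph \<Rightarrow> 'a list \<Rightarrow> bool" where
  "graph_cycle G xs \<longleftrightarrow> 3 \<le> length xs \<and> distinct xs \<and>
     successively (adjacent G) xs \<and> adjacent G (last xs) (hd xs)"

definition is_tree :: "'a ugraph \<Rightarrow> bool" where
  "is_tree G \<longleftrightarrow> simple_graph G \<and> connected_graph G \<and> (\<nexists>xs. graph_cycle G xs)"

definition graph_isomorphic :: "'a ugraph \<Rightarrow> 'b ugraph \<Rightarrow> bool" where
  "graph_isomorphic G H \<longleftrightarrow> (\<exists>f. bij_betw f (verts G) (verts H) \<and>
     (\<forall>u\<in>verts G. \<forall>v\<in>verts G. adjacent G u v \<longleftrightarrow> adjacent H (f u) (f v)))"

text \<open>
  Trees are represented with natural numbers as vertices. An arbitrary set of \<open>n\<close> numbers is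
  allowed as the vertex set, so an isomorphism class contains every such copy of the tree.
\<close>

definition trees :: "nat \<Rightarrow> nat ugraph set" where
  "trees n = {T. is_tree T \<and> card (verts T) = n}"

definition tree_iso_rel :: "nat \<Rightarrow> (nat ugraph \<times> nat ugraph) set" where
  "tree_iso_rel n = {(S, T). S \<in> trees n \<and> T \<in> trees n \<and> graph_isomorphic S T}"


section \<open>Plane rooted trees and transpositions\<close>

text \<open>
  \<open>Node v ts\<close> has root \<open>v\<close>; the list \<open>ts\<close> holds the subtrees at the children of \<open>v\<close>
  from left to right. Vertices carry names; only terms in which all names differ
  represent pr-trees.
\<close>

datatype 'a prtree = Node (root: 'a) (children: "'a prtree list")

fun preorder :: "'a prtree \<Rightarrow> 'a list" where
  "preorder (Node v ts) = v # concat (map preorder ts)"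

fun prtree_edges :: "'a prtree \<Rightarrow> 'a set set" where
  "prtree_edges (Node v ts) = (\<Union>t\<in>set ts. insert {v, root t} (prtree_edges t))"

definition plane_rooted_version :: "'a prtree \<Rightarrow> 'a ugraph \<Rightarrow> bool" where
  "plane_rooted_version t T \<longleftrightarrow> distinct (preorder t) \<and>
     verts T = set (preorder t) \<and> edges T = prtree_edges t"

text \<open>
  The walk around the tree meets \<open>A, B, A, C\<close> with \<open>B\<close> of degree one in two situations:
  \<open>C\<close> is the child of \<open>A\<close> following the leaf \<open>B\<close> (\<open>down\<close>), or \<open>B\<close> is the last child of \<open>A\<close>
  and \<open>C\<close> is the parent of \<open>A\<close> (\<open>up\<close>). The rule \<open>inside\<close> applies a transposition within a
  subtree.
\<close>

inductive transposition :: "'a prtree \<Rightarrow> 'a prtree \<Rightarrow> bool" where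
  down: "transposition (Node A (ls @ Node B [] # Node C ts # rs))
                       (Node A (ls @ Node C (Node B [] # ts) # rs))"
| up: "transposition (Node C (ls @ Node A (ts @ [Node B []]) # rs))
                     (Node C (ls @ Node A ts # Node B [] # rs))"
| inside: "transposition s t \<Longrightarrow> transposition (Node v (ls @ s # rs)) (Node v (ls @ t # rs))"


section \<open>The graph of trees\<close>

text \<open>
  Graphs are simple, hence \<open>X \<noteq> Y\<close>. For even \<open>n\<close>, the case of interest, this excludes
  nothing: a transposition changes the size of each colour class of the tree by one.
\<close>

definition tree_classes_adjacent :: "nat ugraph set \<Rightarrow> nat ugraph set \<Rightarrow> bool" where
  "tree_classes_adjacent X Y \<longleftrightarrow> X \<noteq> Y \<and>
     (\<exists>S\<in>X. \<exists>T\<in>Y. \<exists>s t. plane_rooted_version s S \<and> plane_rooted_version t T \<and>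
        (transposition s t \<or> transposition t s))"

definition graph_of_trees :: "nat \<Rightarrow> nat ugraph set ugraph" where
  "graph_of_trees n =
     \<lparr> verts = trees n // tree_iso_rel n,
       edges = {{X, Y} | X Y. X \<in> trees n // tree_iso_rel n \<and> Y \<in> trees n // tree_iso_rel n \<and>
                  tree_classes_adjacent X Y} \<rparr>"


section \<open>Planarity\<close>

text \<open>
  Planarity is meant topologically: the graph can be drawn in the plane without crossings.
\<close>

definition plane_drawing :: "'a ugraph \<Rightarrow> ('a \<Rightarrow> complex) \<Rightarrow> ('a set \<Rightarrow> real \<Rightarrow> complex) \<Rightarrow> bool" where
  "plane_drawing G p g \<longleftrightarrow>
     inj_on p (verts G) \<and>
     (\<forall>e\<in>edges G. arc (g e) \<and> {pathstart (g e), pathfinish (g e)} = p ` e \<and>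
        path_image (g e) \<inter> p ` verts G = p ` e) \<and>
     (\<forall>e\<in>edges G. \<forall>f\<in>edges G. e \<noteq> f \<longrightarrow>
        path_image (g e) \<inter> path_image (g f) = p ` (e \<inter> f))"

definition planar :: "'a ugraph \<Rightarrow> bool" where
  "planar G \<longleftrightarrow> (\<exists>p g. plane_drawing G p g)"

end

theory Submission
  imports Defs
begin

text \<open>
  \<open>G\<^sub>1\<^sub>0\<close> contains a subdivision of \<open>K\<^sub>3\<^sub>,\<^sub>3\<close> with only nine vertices: two vertices of one side are joined
  directly to all three vertices of the other, the third one by paths of length two.

  In a plane drawing of \<open>K\<^sub>3\<^sub>,\<^sub>3\<close>, a Hamiltonian hexagon is a Jordan curve, and each of the three
  remaining edges lies inside or outside it, so two of them lie on the same side. Their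
  endpoints alternate on the hexagon. If both are inside, one of them cuts the inside into two
  parts, and the other would have to join them; an inversion centred at an inner point
  reduces the outer case to the inner one.
\<close>


section \<open>Non-planarity of a partly subdivided $K_{3,3}$\<close>

text \<open>The parametrisation is forgotten, so that arcs can be reversed, joined by union and
  compared by intersection without handling paths.\<close>

definition arc_between :: "complex set \<Rightarrow> complex \<Rightarrow> complex \<Rightarrow> bool" where
  "arc_between S a b \<longleftrightarrow> (\<exists>g. arc g \<and> path_image g = S \<and> pathstart g = a \<and> pathfinish g = b)"

lemma arc_between_sym:
  assumes "arc_between S a b" shows "arc_between S b a"
  using assms unfolding arc_between_def
  by (metis arc_reversepath path_image_reversepath pathfinish_reversepath pathstart_reversepath)

lemma arc_between_join:
  assumes "arc_between S a b" "arc_between T b c" "S \<inter> T \<subseteq> {b}"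
  shows "arc_between (S \<union> T) a c"
proof -
  obtain g h where "arc g" "path_image g = S" "pathstart g = a" "pathfinish g = b"
    and "arc h" "path_image h = T" "pathstart h = b" "pathfinish h = c"
    using assms(1,2) unfolding arc_between_def by blast
  with assms(3) show ?thesis unfolding arc_between_def
    by (intro exI[of _ "g +++ h"]) (auto simp: arc_join path_image_join)
qed

lemma arc_between_endpoints:
  assumes "arc_between S a b" shows "a \<in> S" "b \<in> S" "a \<noteq> b"
  using assms unfolding arc_between_def
  by (auto dest: arc_distinct_ends)

lemma arc_between_compact: "arc_between S a b \<Longrightarrow> compact S"
  unfolding arc_between_def by (metis arc_imp_path compact_path_image)

lemma arc_between_endless_connected:
  assumes "arc_between S a b" shows "connected (S - {a, b})"
  using assms unfolding arc_between_def
  by (metis arc_imp_simple_path connected_simple_path_endless)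

lemma arc_between_endless_nonempty:
  assumes "arc_between S a b" shows "S - {a, b} \<noteq> {}"
  using assms unfolding arc_between_def
  by (metis arc_imp_simple_path nonempty_simple_path_endless)

text \<open>The open unit interval is dense in the closed one, and continuity carries this over to
  the arc. Thus, if the arc without its ends lies in a region, the ends lie in the closure of that
  region.\<close>

lemma arc_between_endless_closure:
  assumes "arc_between S a b" shows "S \<subseteq> closure (S - {a, b})"
proof -
  obtain g where g: "arc g" "path_image g = S" "pathstart g = a" "pathfinish g = b"
    using assms unfolding arc_between_def by blast
  then have e: "S - {a, b} = g ` {0<..<1}"
    using simple_path_endless[OF arc_imp_simple_path] by metis
  have "continuous_on (closure {0<..<1::real}) g"
    using g by (simp add: arc_def path_def)
  then have "g ` closure {0<..<1} \<subseteq> closure (g ` {0<..<1})"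
    by (rule image_closure_subset) (auto intro: closure_subset[THEN subsetD])
  then show ?thesis using g e by (simp add: path_image_def)
qed

lemma arc_between_image:
  assumes "arc_between S a b" "continuous_on S h" "inj_on h S"
  shows "arc_between (h ` S) (h a) (h b)"
proof -
  obtain g where g: "arc g" "path_image g = S" "pathstart g = a" "pathfinish g = b"
    using assms unfolding arc_between_def by blast
  have "simple_path (h \<circ> g)"
    using g assms by (intro simple_path_continuous_image) (auto simp: arc_imp_simple_path)
  moreover have "h a \<noteq> h b"
    using arc_between_endpoints[OF assms(1)] assms(3) by (auto dest: inj_onD)
  ultimately show ?thesis unfolding arc_between_def using g
    by (intro exI[of _ "h \<circ> g"])
       (auto simp: arc_simple_path path_image_compose pathstart_compose pathfinish_compose)
qed

section \<open>Chords of a Jordan curve with alternating ends\<close>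

text \<open>The chord \<open>X\<close> divides the inside of the curve into
  \<open>inside (C1 \<union> X)\<close> and \<open>inside (C2 \<union> X)\<close>. Since
  \<open>Y\<close> without its ends is connected and misses \<open>X\<close>, it stays in one of
  these two regions. The closure of the first does not reach \<open>v\<close>, that of the second
  does not reach \<open>u\<close>.\<close>

lemma crossing_chords_inside:
  assumes C1: "arc_between C1 a b" and C2: "arc_between C2 a b" and "C1 \<inter> C2 = {a, b}"
    and X: "arc_between X a b" "X - {a, b} \<subseteq> inside (C1 \<union> C2)"
    and Y: "arc_between Y u v" "Y - {u, v} \<subseteq> inside (C1 \<union> C2)"
    and u: "u \<in> C1 - {a, b}" and v: "v \<in> C2 - {a, b}" and XY: "X \<inter> Y = {}"
  shows False
proof -
  have ab: "a \<noteq> b" "a \<in> X" "b \<in> X" "a \<in> C1" "b \<in> C1" "a \<in> C2" "b \<in> C2"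
    using arc_between_endpoints C1 C2 X by blast+
  have dis: "inside (C1 \<union> C2) \<inter> (C1 \<union> C2) = {}"
    by (rule inside_no_overlap)
  have CX: "C1 \<inter> X = {a, b}" "C2 \<inter> X = {a, b}"
    using X(2) dis ab by blast+
  have ne: "X \<inter> inside (C1 \<union> C2) \<noteq> {}"
    using arc_between_endless_nonempty[OF X(1)] X(2) by blast
  obtain c1 where c1: "arc c1" "path_image c1 = C1" "pathstart c1 = a" "pathfinish c1 = b"
    using C1 unfolding arc_between_def by blast
  obtain c2 where c2: "arc c2" "path_image c2 = C2" "pathstart c2 = a" "pathfinish c2 = b"
    using C2 unfolding arc_between_def by blast
  obtain c where c: "arc c" "path_image c = X" "pathstart c = a" "pathfinish c = b"
    using X(1) unfolding arc_between_def by blast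
  have split: "inside (C1 \<union> X) \<inter> inside (C2 \<union> X) = {}"
     "inside (C1 \<union> X) \<union> inside (C2 \<union> X) \<union> (X - {a, b}) = inside (C1 \<union> C2)"
    using split_inside_simple_closed_curve[of c1 a b c2 c] c1 c2 c assms(3) CX ne ab
    by (metis arc_imp_simple_path)+
  have cl: "closed (C1 \<union> X)" "closed (C2 \<union> X)"
    using C1 C2 X(1) by (auto dest!: arc_between_compact intro!: compact_imp_closed)
  have op: "open (inside (C1 \<union> X))" "open (inside (C2 \<union> X))"
    using cl by (auto intro: open_inside)
  let ?Y = "Y - {u, v}"
  have "?Y \<subseteq> inside (C1 \<union> X) \<union> inside (C2 \<union> X)"
    using Y(2) split(2) XY by blast
  then have "?Y \<subseteq> inside (C1 \<union> X) \<or> ?Y \<subseteq> inside (C2 \<union> X)"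
    using connectedD[OF arc_between_endless_connected[OF Y(1)] op] split(1) by blast
  then show False
  proof
    assume "?Y \<subseteq> inside (C1 \<union> X)"
    then have "Y \<subseteq> closure (inside (C1 \<union> X))"
      using arc_between_endless_closure[OF Y(1)] closure_mono by blast
    then have "v \<in> C1 \<union> X \<union> inside (C1 \<union> X)"
      using closure_inside_subset[OF cl(1)] arc_between_endpoints(2)[OF Y(1)] by blast
    \<comment> \<open>As an inner point of \<open>C2\<close>, \<open>v\<close> lies neither on
      \<open>C1\<close> nor on \<open>X\<close>; lying on the curve, it is not in its inside
      either.\<close>
    then show False
      using v assms(3) CX split(2) dis by blast
  next
    assume "?Y \<subseteq> inside (C2 \<union> X)"
    then have "Y \<subseteq> closure (inside (C2 \<union> X))"
      using arc_between_endless_closure[OF Y(1)] closure_mono by blast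
    then have "u \<in> C2 \<union> X \<union> inside (C2 \<union> X)"
      using closure_inside_subset[OF cl(2)] arc_between_endpoints(1)[OF Y(1)] by blast
    then show False
      using u assms(3) CX split(2) dis by blast
  qed
qed

lemma inversion_outside_subset_inside:
  fixes z0 :: complex
  assumes "compact H" and z0: "z0 \<in> inside H"
  defines "h \<equiv> \<lambda>z. inverse (z - z0)"
  shows "h ` outside H \<subseteq> inside (h ` H)"
proof (rule image_subsetI)
  fix z assume z: "z \<in> outside H"
  have z0H: "z0 \<notin> H" "z0 \<notin> outside H"
    using z0 by (auto simp: inside_def outside_def)
  have injh: "inj h" by (auto simp: h_def inj_def)
  have hz: "h z \<notin> h ` H"
    using z by (simp add: inj_image_mem_iff[OF injh] outside_def)
  let ?K = "connected_component_set (- h ` H) (h z)"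
  have "compact (h ` H)"
    using \<open>compact H\<close> z0H unfolding h_def
    by (intro compact_continuous_image continuous_intros) auto
  then have "open ?K"
    by (intro open_connected_component) (auto intro: compact_imp_closed)
  \<comment> \<open>The inverse map \<open>?k\<close> is not continuous at 0, so this point is taken
    out; an open connected set in the plane stays connected when one point is deleted.\<close>
  then have conn: "connected (?K - {0})"
    by (intro connected_open_delete) auto
  have hz0: "h z \<noteq> 0" using z z0H by (auto simp: h_def)
  let ?k = "\<lambda>w. inverse w + z0"
  have hk: "h (?k w) = w" for w by (simp add: h_def)
  have "connected (?k ` (?K - {0}))"
    using conn by (intro connected_continuous_image continuous_intros) auto
  moreover have "?k ` (?K - {0}) \<subseteq> - H"
  proof (rule image_subsetI)
    fix w assume "w \<in> ?K - {0}"
    then have "w \<notin> h ` H" using connected_component_subset by blast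
    then show "?k w \<in> - H" using hk by (metis ComplI imageI)
  qed
  moreover have "z \<in> ?k ` (?K - {0})"
    using hz hz0 by (intro image_eqI[of _ _ "h z"]) (auto simp: h_def)
  ultimately have "?k ` (?K - {0}) \<subseteq> connected_component_set (- H) z"
    by (intro connected_component_maximal)
  also have "\<dots> \<subseteq> outside H"
    using z outside_same_component by blast
  finally have K: "?K - {0} \<subseteq> h ` outside H"
    using hk by (metis (no_types, lifting) image_subset_iff subsetI image_eqI)
  have "open (inside H)"
    using \<open>compact H\<close> by (intro open_inside compact_imp_closed)
  then obtain r where r: "r > 0" "ball z0 r \<subseteq> inside H"
    using z0 open_contains_ball by blast
  have "norm (h y) \<le> inverse r" if "y \<in> outside H" for y
  proof -
    have "y \<notin> ball z0 r"
      using that r by (auto simp: inside_def outside_def)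
    then have "r \<le> norm (y - z0)" by (simp add: dist_norm norm_minus_commute)
    then show ?thesis using r by (simp add: h_def norm_inverse le_imp_inverse_le)
  qed
  then have "bounded (h ` outside H)"
    unfolding bounded_iff by blast
  \<comment> \<open>The deleted point 0 is put back to cover all of \<open>?K\<close>.\<close>
  then have "bounded (insert 0 (h ` outside H))"
    by simp
  then have "bounded ?K"
    by (rule bounded_subset) (use K in blast)
  then show "h z \<in> inside (h ` H)"
    using hz by (simp add: inside_def)
qed

lemma crossing_chords_same_side:
  assumes C1: "arc_between C1 a b" and C2: "arc_between C2 a b" and C: "C1 \<inter> C2 = {a, b}"
    and X: "arc_between X a b" and Y: "arc_between Y u v"
    and u: "u \<in> C1 - {a, b}" and v: "v \<in> C2 - {a, b}" and XY: "X \<inter> Y = {}"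
    and side: "(X - {a, b}) \<union> (Y - {u, v}) \<subseteq> inside (C1 \<union> C2) \<or>
               (X - {a, b}) \<union> (Y - {u, v}) \<subseteq> outside (C1 \<union> C2)"
  shows False
proof -
  let ?H = "C1 \<union> C2"
  have False if out: "(X - {a, b}) \<union> (Y - {u, v}) \<subseteq> outside ?H"
  proof -
    \<comment> \<open>By the Jordan curve theorem there is an inner point to serve as the centre of
      the inversion.\<close>
    have "inside ?H \<noteq> {}"
    proof -
      obtain c1 where c1: "arc c1" "path_image c1 = C1" "pathstart c1 = a" "pathfinish c1 = b"
        using C1 unfolding arc_between_def by blast
      obtain c2 where c2: "arc c2" "path_image c2 = C2" "pathstart c2 = b" "pathfinish c2 = a"
        using arc_between_sym[OF C2] unfolding arc_between_def by blast
      have "simple_path (c1 +++ c2)"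
        using c1 c2 C by (intro simple_path_join_loop) auto
      from Jordan_inside_outside[OF this] show ?thesis
        using c1 c2 by (simp add: path_image_join)
    qed
    then obtain z0 where z0: "z0 \<in> inside ?H" by blast
    define h where "h \<equiv> \<lambda>z. inverse (z - z0)"
    have injh: "inj h" by (auto simp: h_def inj_def)
    have comp: "compact ?H" using C1 C2 arc_between_compact by blast
    have hs: "h ` outside ?H \<subseteq> inside (h ` ?H)"
      unfolding h_def by (rule inversion_outside_subset_inside[OF comp z0])
    have z0n: "z0 \<notin> C1" "z0 \<notin> C2" "z0 \<notin> outside ?H"
      using z0 by (auto simp: inside_def outside_def)
    have ends: "a \<in> C1" "b \<in> C1" "a \<in> C2" "b \<in> C2"
      using arc_between_endpoints C1 C2 by blast+
    \<comment> \<open>The centre avoids all four arcs, so the inversion is continuous on each of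
      them and maps arcs to arcs.\<close>
    have z0X: "z0 \<notin> X" "z0 \<notin> Y"
      using out z0n u v ends by auto
    have img: "arc_between (h ` S) (h p) (h q)" if "arc_between S p q" "z0 \<notin> S" for S p q
      using that injh unfolding h_def
      by (intro arc_between_image) (auto intro!: continuous_intros intro: inj_on_subset)
    show False
    proof (rule crossing_chords_inside)
      show "arc_between (h ` C1) (h a) (h b)" "arc_between (h ` C2) (h a) (h b)"
        "arc_between (h ` X) (h a) (h b)" "arc_between (h ` Y) (h u) (h v)"
        using img C1 C2 X Y z0n z0X by blast+
      show "h ` C1 \<inter> h ` C2 = {h a, h b}"
        using C by (simp flip: image_Int[OF injh])
      show "h ` X - {h a, h b} \<subseteq> inside (h ` C1 \<union> h ` C2)"
        "h ` Y - {h u, h v} \<subseteq> inside (h ` C1 \<union> h ` C2)"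
        using hs out by (auto simp: image_Un)
      show "h u \<in> h ` C1 - {h a, h b}" "h v \<in> h ` C2 - {h a, h b}"
        using u v injh by (auto dest: injD)
      show "h ` X \<inter> h ` Y = {}"
        using XY by (simp flip: image_Int[OF injh])
    qed
  qed
  then show False
    using side crossing_chords_inside[OF C1 C2 C X _ Y _ u v XY] by blast
qed


lemma connected_inside_or_outside:
  fixes H :: "complex set"
  assumes "closed H" "connected S" "S \<inter> H = {}"
  shows "S \<subseteq> inside H \<or> S \<subseteq> outside H"
proof -
  have "S \<subseteq> inside H \<union> outside H" using assms(3) by auto
  then show ?thesis
    using connectedD[OF assms(2) open_inside[OF assms(1)] open_outside[OF assms(1)]]
      inside_Int_outside[of H] by blast
qed

section \<open>Drawings of K_{3,3} and of its subdivision\<close>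

lemma no_K33_drawing:
  fixes a b :: "nat \<Rightarrow> complex" and E :: "nat \<Rightarrow> nat \<Rightarrow> complex set"
  assumes arc: "\<And>i j. i < 3 \<Longrightarrow> j < 3 \<Longrightarrow> arc_between (E i j) (a i) (b j)"
    and same_a: "\<And>i j k. i < 3 \<Longrightarrow> j < 3 \<Longrightarrow> k < 3 \<Longrightarrow> j \<noteq> k \<Longrightarrow> E i j \<inter> E i k = {a i}"
    and same_b: "\<And>i j k. i < 3 \<Longrightarrow> j < 3 \<Longrightarrow> k < 3 \<Longrightarrow> i \<noteq> k \<Longrightarrow> E i j \<inter> E k j = {b j}"
    and disj: "\<And>i j k l. i < 3 \<Longrightarrow> j < 3 \<Longrightarrow> k < 3 \<Longrightarrow> l < 3 \<Longrightarrow> i \<noteq> k \<Longrightarrow> j \<noteq> l \<Longrightarrow>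
                 E i j \<inter> E k l = {}"
  shows False
proof -
  \<comment> \<open>\<open>H i k l\<close> is the hexagon through \<open>a i\<close>,
    \<open>b i\<close>, \<open>a k\<close>, \<open>b k\<close>, \<open>a l\<close>,
    \<open>b l\<close>, written as two paths from \<open>a i\<close> to \<open>b k\<close>, the ends
    of the chord \<open>E i k\<close>. The three edges off the hexagon are \<open>E i k\<close>,
    \<open>E k l\<close> and \<open>E l i\<close>.\<close>
  define H where "H \<equiv> \<lambda>i k l. (E i i \<union> E k i \<union> E k k) \<union> (E i l \<union> E l l \<union> E l k)"
  define chord where "chord \<equiv> \<lambda>i k. E i k - {a i, b k}"
  have crossing: False
    if lt: "i < 3" "k < 3" "l < 3" and ne: "i \<noteq> k" "k \<noteq> l" "i \<noteq> l"
      and side: "chord i k \<union> chord l i \<subseteq> inside (H i k l) \<or>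
                 chord i k \<union> chord l i \<subseteq> outside (H i k l)" for i k l
  proof -
    note ne' = ne ne[symmetric]
    note Es = same_a same_b disj lt ne' Int_Un_distrib Int_Un_distrib2
    have sym: "arc_between (E r s) (b s) (a r)" if "r < 3" "s < 3" for r s
      using that arc arc_between_sym by blast
    have C1: "arc_between (E i i \<union> E k i \<union> E k k) (a i) (b k)"
      by (intro arc_between_join[where b = "a k"] arc_between_join[where b = "b i"] arc sym) (auto simp: Es)
    have C2: "arc_between (E i l \<union> E l l \<union> E l k) (a i) (b k)"
      by (intro arc_between_join[where b = "a l"] arc_between_join[where b = "b l"] arc sym) (auto simp: Es)
    have mem: "a r \<in> E r s" "b s \<in> E r s" if "r < 3" "s < 3" for r s
      using that arc arc_between_endpoints by blast+
    \<comment> \<open>No distinctness of the points \<open>a r\<close> and \<open>b s\<close> is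
      assumed; points on disjoint edges are distinct.\<close>
    have "E l l \<inter> E i i = {}" "E l l \<inter> E k k = {}" "E k i \<inter> E i l = {}" "E k i \<inter> E l k = {}"
      using lt ne' by (simp_all add: disj)
    moreover have "a l \<in> E l l" "a i \<in> E i i" "b k \<in> E k k"
        "b i \<in> E k i" "a i \<in> E i l" "b k \<in> E l k"
      using mem lt by simp_all
    ultimately have "a l \<notin> {a i, b k}" "b i \<notin> {a i, b k}"
      by auto
    then have u: "b i \<in> E i i \<union> E k i \<union> E k k - {a i, b k}"
      and v: "a l \<in> E i l \<union> E l l \<union> E l k - {a i, b k}"
      using mem lt by auto
    have C: "(E i i \<union> E k i \<union> E k k) \<inter> (E i l \<union> E l l \<union> E l k) = {a i, b k}"
      by (simp add: Es; blast)
    have XY: "E i k \<inter> E l i = {}" by (simp add: Es)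
    show False
      by (rule crossing_chords_same_side[OF C1 C2 C arc[of i k] sym[of l i] u v XY])
        (use lt side in \<open>auto simp: H_def chord_def insert_commute\<close>)
  qed
  have side: "chord i k \<subseteq> inside (H 0 1 2) \<or> chord i k \<subseteq> outside (H 0 1 2)"
    if "(i, k) \<in> {(0, 1), (1, 2), (2, 0)}" for i k
  proof (rule connected_inside_or_outside)
    have "compact (E r s)" if "r < 3" "s < 3" for r s
      using arc that arc_between_compact by blast
    then show "closed (H 0 1 2)"
      unfolding H_def by (intro closed_Un) (auto intro!: compact_imp_closed)
    show "connected (chord i k)"
      using that arc_between_endless_connected[OF arc[of i k]] unfolding chord_def by auto
    have "E i k \<inter> H 0 1 2 \<subseteq> {a i, b k}"
      using that unfolding H_def insert_iff prod.inject empty_iff simp_thms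
      by (elim disjE conjE; simp add: Int_Un_distrib same_a same_b disj)
    then show "chord i k \<inter> H 0 1 2 = {}"
      unfolding chord_def by blast
  qed
  \<comment> \<open>A cyclic shift of the indices fixes the hexagon and permutes its three chords,
    so \<open>crossing\<close> excludes each pair of chords on a common side. Three chords on two
    sides always contain such a pair.\<close>
  have rot: "H 1 2 0 = H 0 1 2" "H 2 0 1 = H 0 1 2"
    unfolding H_def by auto
  show False
    using side[of 0 1] side[of 1 2] side[of 2 0]
      crossing[of 0 1 2] crossing[of 1 2 0, unfolded rot] crossing[of 2 0 1, unfolded rot]
    by auto
qed

text \<open>A drawing prescribes the ends of an edge only as an unordered pair, so the arc may have
  to be reversed.\<close>

lemma plane_drawing_edge_arc:
  assumes "plane_drawing G p g" "{x, y} \<in> edges G"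
  shows "arc_between (path_image (g {x, y})) (p x) (p y)"
proof -
  have "arc (g {x, y})" "{pathstart (g {x, y}), pathfinish (g {x, y})} = {p x, p y}"
    using assms unfolding plane_drawing_def by auto
  then have "arc_between (path_image (g {x, y})) (p x) (p y) \<or>
             arc_between (path_image (g {x, y})) (p y) (p x)"
    unfolding arc_between_def doubleton_eq_iff by blast
  then show ?thesis using arc_between_sym by blast
qed

text \<open>
  The graph on the indices \<open>0, \<dots>, 8\<close> is \<open>K\<^sub>3\<^sub>,\<^sub>3\<close> with sides \<open>{0, 1, 2}\<close> and \<open>{3, 4, 5}\<close>,
  in which the edge from \<open>i\<close> to \<open>5\<close> is subdivided by the vertex \<open>6 + i\<close>.
\<close>

lemma not_planar_if_K33_subdivision:
  assumes inj: "inj_on x {..<9::nat}" and verts: "x ` {..<9} \<subseteq> verts G"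
    and edges: "\<And>i. i < 3 \<Longrightarrow> {x i, x 3} \<in> edges G"
      "\<And>i. i < 3 \<Longrightarrow> {x i, x 4} \<in> edges G"
      "\<And>i. i < 3 \<Longrightarrow> {x i, x (6 + i)} \<in> edges G"
      "\<And>i. i < 3 \<Longrightarrow> {x (6 + i), x 5} \<in> edges G"
  shows "\<not> planar G"
proof
  assume "planar G"
  then obtain p g where d: "plane_drawing G p g" unfolding planar_def by blast
  define q where "q = p \<circ> x"
  have injq: "inj_on q {..<9}"
    unfolding q_def using d inj verts
    by (intro comp_inj_on) (auto simp: plane_drawing_def intro: inj_on_subset)
  \<comment> \<open>\<open>F i j\<close> lists the edges of the path that replaces the edge from
    \<open>i\<close> to \<open>3 + j\<close> of K_{3,3}; only the paths to 5, those with
    \<open>j = 2\<close>, have an intermediate vertex. \<open>I\<close> draws a single edge and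
    \<open>E\<close> a whole path.\<close>
  define F where "F \<equiv> \<lambda>i j. if j < 2 then {{i, 3 + j}} else {{i, 6 + i}, {6 + i, 5 :: nat}}"
  define I where "I \<equiv> \<lambda>e. path_image (g (x ` e))"
  define E where "E \<equiv> \<lambda>i j. \<Union> (I ` F i j)"
  have less3: "i < 3 \<longleftrightarrow> i = 0 \<or> i = 1 \<or> i = 2" for i :: nat by auto
  have F_edge: "x ` e \<in> edges G \<and> e \<subseteq> {..<9}" if "e \<in> F i j" "i < 3" "j < 3" for e i j
  proof -
    have "j = 0 \<or> j = 1 \<or> j = 2" using that less3 by blast
    then have "e \<in> {{i, 3}, {i, 4}, {i, 6 + i}, {6 + i, 5}}"
      using that(1) unfolding F_def by (elim disjE) auto
    then show ?thesis using edges[OF that(2)] that(2) by auto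
  qed
  have I_arc: "arc_between (I {r, s}) (q r) (q s)" if "{x r, x s} \<in> edges G" for r s
    using plane_drawing_edge_arc[OF d that] by (simp add: I_def q_def)
  have I_Int: "I e \<inter> I f = q ` (e \<inter> f)"
    if "e \<in> F i j" "f \<in> F k l" "e \<noteq> f" "i < 3" "j < 3" "k < 3" "l < 3" for e f i j k l
  proof -
    have *: "x ` e \<in> edges G" "x ` f \<in> edges G" "e \<subseteq> {..<9}" "f \<subseteq> {..<9}"
      using F_edge that by blast+
    then have "x ` e \<noteq> x ` f" "x ` e \<inter> x ` f = x ` (e \<inter> f)"
      using inj that(3) by (auto simp: inj_on_image_eq_iff inj_on_image_Int)
    then show ?thesis
      using d * unfolding plane_drawing_def I_def q_def by (metis image_comp)
  qed
  \<comment> \<open>Different paths share no edge. Hence every common point of their drawings comes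
    from two different edges and is the drawing of a common vertex, which reduces the topological
    conditions to index sets.\<close>
  have E_Int: "E i j \<inter> E k l = q ` (\<Union> (F i j) \<inter> \<Union> (F k l))"
    if lt: "i < 3" "j < 3" "k < 3" "l < 3" and "(i, j) \<noteq> (k, l)" for i j k l
  proof -
    have "F i j \<inter> F k l = {}"
      using that unfolding F_def by (auto simp: less3 doubleton_eq_iff)
    then have "E i j \<inter> E k l = (\<Union>e\<in>F i j. \<Union>f\<in>F k l. q ` (e \<inter> f))"
      unfolding E_def using I_Int lt by (fastforce simp: Int_UN_distrib2)
    also have "\<dots> = q ` (\<Union>e\<in>F i j. \<Union>f\<in>F k l. e \<inter> f)"
      by (simp only: image_UN)
    also have "(\<Union>e\<in>F i j. \<Union>f\<in>F k l. e \<inter> f) = \<Union> (F i j) \<inter> \<Union> (F k l)"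
      by blast
    finally show ?thesis .
  qed
  have Union_F: "\<Union> (F i j) = (if j < 2 then {i, 3 + j} else {i, 6 + i, 5})" for i j
    unfolding F_def by auto
  \<comment> \<open>The intermediate vertex \<open>6 + i\<close> lies on one path only, so different
    paths meet exactly where the corresponding edges of K_{3,3} do.\<close>
  have F_Int: "\<Union> (F i j) \<inter> \<Union> (F k l) = {i, 3 + j} \<inter> {k, 3 + l}"
    if "i < 3" "j < 3" "k < 3" "l < 3" "(i, j) \<noteq> (k, l)" for i j k l
  proof -
    have "j < 2 \<or> j = 2" "l < 2 \<or> l = 2" using that by auto
    then show ?thesis
      using that by (elim disjE) (auto simp: Union_F)
  qed
  show False
  proof (rule no_K33_drawing[of E q "\<lambda>j. q (3 + j)"])
    fix i j :: nat assume ij: "i < 3" "j < 3"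
    show "arc_between (E i j) (q i) (q (3 + j))"
    proof (cases "j < 2")
      case True
      then show ?thesis
        using I_arc[of i "3 + j"] F_edge[of "{i, 3 + j}" i j] ij by (simp add: E_def F_def)
    next
      case False
      then have j: "j = 2" using ij by simp
      have "arc_between (I {i, 6 + i} \<union> I {6 + i, 5}) (q i) (q 5)"
      proof (rule arc_between_join)
        show "I {i, 6 + i} \<inter> I {6 + i, 5} \<subseteq> {q (6 + i)}"
          using I_Int[of "{i, 6 + i}" i 2 "{6 + i, 5}" i 2] ij
          by (auto simp: F_def doubleton_eq_iff)
      qed (use I_arc edges ij in auto)
      then show ?thesis using j by (simp add: E_def F_def)
    qed
  next
    fix i j k :: nat assume lt: "i < 3" "j < 3" "k < 3" "j \<noteq> k"
    then have "{i, 3 + j} \<inter> {i, 3 + k} = {i}" by auto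
    then show "E i j \<inter> E i k = {q i}" using lt by (simp add: E_Int F_Int)
  next
    fix i j k :: nat assume lt: "i < 3" "j < 3" "k < 3" "i \<noteq> k"
    then have "{i, 3 + j} \<inter> {k, 3 + j} = {3 + j}" by auto
    then show "E i j \<inter> E k j = {q (3 + j)}" using lt by (simp add: E_Int F_Int)
  next
    fix i j k l :: nat assume lt: "i < 3" "j < 3" "k < 3" "l < 3" "i \<noteq> k" "j \<noteq> l"
    then have "{i, 3 + j} \<inter> {k, 3 + l} = {}" by auto
    then show "E i j \<inter> E k l = {}" using lt by (simp add: E_Int F_Int)
  qed
qed

section \<open>Labelled trees given by parent functions\<close>

text \<open>The list \<open>fs\<close> names the vertices \<open>0, 1, \<dots>\<close> of the tree
  with parent function \<open>P\<close>. Varying \<open>fs\<close> alone gives the isomorphic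
  copies, which is how the names in two trees related by a transposition are matched.\<close>

definition parent_graph :: "'a list \<Rightarrow> (nat \<Rightarrow> nat) \<Rightarrow> 'a ugraph" where
  "parent_graph fs P =
     \<lparr> verts = set fs, edges = (\<lambda>i. {fs ! i, fs ! P i}) ` {1..<length fs} \<rparr>"

text \<open>Since a parent has a smaller number than its child, vertex 0 is the root; the value
  \<open>P 0\<close> is arbitrary.\<close>

definition parent_function :: "nat \<Rightarrow> (nat \<Rightarrow> nat) \<Rightarrow> bool" where
  "parent_function n P \<longleftrightarrow> 0 < n \<and> (\<forall>i\<in>{1..<n}. P i < i)"

lemma graph_cycle_two_neighbours:
  assumes "graph_cycle G xs" "x \<in> set xs"
  obtains y z where "y \<in> set xs" "z \<in> set xs" "y \<noteq> z" "adjacent G x y" "adjacent G z x"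
proof -
  obtain ys zs where xs: "xs = ys @ x # zs"
    using split_list[OF assms(2)] by blast
  \<comment> \<open>Rotated to begin at \<open>x\<close>, the cycle reads \<open>x # ?w\<close>; the
    two neighbours are the first and last entries of \<open>?w\<close>, which has at least two
    distinct entries.\<close>
  let ?w = "zs @ ys"
  have gc: "3 \<le> length xs" "distinct xs" and cyc: "adjacent G (last xs) (hd xs)"
    and succ: "successively (adjacent G) xs"
    using assms(1) unfolding graph_cycle_def by blast+
  have w: "length ?w \<ge> 2" "distinct ?w"
    using gc xs by auto
  show thesis
  proof (rule that)
    show "hd ?w \<in> set xs" "last ?w \<in> set xs"
      using w xs hd_in_set[of ?w] last_in_set[of ?w] by force+
    show "hd ?w \<noteq> last ?w"
    proof -
      have "?w ! 0 \<noteq> ?w ! (length ?w - 1)"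
        using w by (subst nth_eq_iff_index_eq) auto
      then show ?thesis using w by (metis hd_conv_nth last_conv_nth list.size(3) not_numeral_le_zero)
    qed
    show "adjacent G x (hd ?w)"
    proof (cases zs)
      case Nil
      then show ?thesis using cyc xs w by (cases ys) auto
    next
      case Cons
      then show ?thesis using succ xs by (simp add: successively_append_iff)
    qed
    show "adjacent G (last ?w) x"
    proof (cases "ys = []")
      case True
      then show ?thesis using cyc xs w by (cases zs) auto
    next
      case False
      then show ?thesis using succ xs by (simp add: successively_append_iff)
    qed
  qed
qed

lemma adjacent_parent_graph_iff:
  assumes "distinct fs" "parent_function (length fs) P" "u < length fs" "v < length fs"
  shows "adjacent (parent_graph fs P) (fs ! u) (fs ! v) \<longleftrightarrow>
           (0 < u \<and> v = P u) \<or> (0 < v \<and> u = P v)"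
proof -
  have lt: "P i < length fs" if "i < length fs" "0 < i" for i
    using assms(2) that unfolding parent_function_def
    by (metis One_nat_def Suc_leI atLeastLessThan_iff less_trans)
  have eq: "{fs ! u, fs ! v} = {fs ! i, fs ! P i} \<longleftrightarrow> {u, v} = {i, P i}"
    if "i \<in> {1..<length fs}" for i
    using assms lt[of i] that by (auto simp: doubleton_eq_iff nth_eq_iff_index_eq)
  have "adjacent (parent_graph fs P) (fs ! u) (fs ! v) \<longleftrightarrow>
      (\<exists>i\<in>{1..<length fs}. {fs ! u, fs ! v} = {fs ! i, fs ! P i})"
    by (simp add: adjacent_def parent_graph_def image_iff)
  also have "\<dots> \<longleftrightarrow> (\<exists>i\<in>{1..<length fs}. {u, v} = {i, P i})"
    by (intro bex_cong refl eq)
  finally show ?thesis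
    using assms(3,4) by (auto simp: doubleton_eq_iff)
qed

lemma adjacent_sym: "adjacent G u v \<Longrightarrow> adjacent G v u"
  by (simp add: adjacent_def insert_commute)

text \<open>Passing from parent to parent ends at the root, which gives connectedness. On a cycle,
  the vertex of largest index would have two different neighbours of smaller index, but only its
  parent is one.\<close>

lemma is_tree_parent_graph:
  assumes "distinct fs" "parent_function (length fs) P"
  shows "is_tree (parent_graph fs P)"
proof -
  let ?G = "parent_graph fs P"
  let ?n = "length fs"
  have par: "P i < i" if "0 < i" "i < ?n" for i
    using assms(2) that unfolding parent_function_def by auto
  have n0: "0 < ?n" using assms(2) unfolding parent_function_def by simp
  have verts: "verts ?G = set fs" by (simp add: parent_graph_def)
  note adj = adjacent_parent_graph_iff[OF assms]
  have simple: "simple_graph ?G"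
    unfolding simple_graph_def
  proof (intro conjI ballI)
    fix e assume "e \<in> edges ?G"
    then obtain i where i: "i \<in> {1..<?n}" "e = {fs ! i, fs ! P i}"
      by (auto simp: parent_graph_def)
    with par[of i] have "P i < i" "i < ?n" by auto
    then show "\<exists>u v. e = {u, v} \<and> u \<noteq> v \<and> u \<in> verts ?G \<and> v \<in> verts ?G"
      using i assms(1)
      by (intro exI[of _ "fs ! i"] exI[of _ "fs ! P i"]) (auto simp: verts nth_eq_iff_index_eq)
  qed (simp add: verts)
  have symp: "symp (adjacent ?G)\<^sup>*\<^sup>*"
    using symp_rtranclp[OF sympI[OF adjacent_sym]] .
  have to_root: "(adjacent ?G)\<^sup>*\<^sup>* (fs ! i) (fs ! 0)" if "i < ?n" for i
    using that
  proof (induction i rule: less_induct)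
    case (less i)
    show ?case
    proof (cases "i = 0")
      case False
      then have "P i < i" using par less.prems by simp
      then have "(adjacent ?G)\<^sup>*\<^sup>* (fs ! P i) (fs ! 0)" "adjacent ?G (fs ! i) (fs ! P i)"
        using less False adj[of i "P i"] by auto
      then show ?thesis by (simp add: converse_rtranclp_into_rtranclp)
    qed simp
  qed
  have "connected_graph ?G"
    unfolding connected_graph_def
  proof (intro conjI ballI)
    show "verts ?G \<noteq> {}" using n0 verts by auto
    fix u v assume "u \<in> verts ?G" "v \<in> verts ?G"
    then have "(adjacent ?G)\<^sup>*\<^sup>* u (fs ! 0)" "(adjacent ?G)\<^sup>*\<^sup>* v (fs ! 0)"
      using to_root verts by (auto simp: in_set_conv_nth)
    then show "(adjacent ?G)\<^sup>*\<^sup>* u v"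
      using symp by (meson rtranclp_trans sympD)
  qed
  moreover have False if cyc: "graph_cycle ?G xs" for xs
  proof -
    have sub: "set xs \<subseteq> set fs"
    proof
      fix x assume "x \<in> set xs"
      then obtain y where "adjacent ?G x y"
        using graph_cycle_two_neighbours[OF cyc] by metis
      then show "x \<in> set fs"
        using simple unfolding simple_graph_def adjacent_def verts by (metis doubleton_eq_iff)
    qed
    define J where "J = {j. j < ?n \<and> fs ! j \<in> set xs}"
    have "xs \<noteq> []" using cyc by (auto simp: graph_cycle_def)
    then obtain j where "j < ?n" "fs ! j = hd xs"
      using sub hd_in_set by (metis in_set_conv_nth subsetD)
    then have "J \<noteq> {}" "finite J"
      using \<open>xs \<noteq> []\<close> by (auto simp: J_def)
    then have m: "Max J \<in> J" and max: "\<And>j. j \<in> J \<Longrightarrow> j \<le> Max J"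
      by simp_all
    obtain y z where yz: "y \<in> set xs" "z \<in> set xs" "y \<noteq> z"
      "adjacent ?G (fs ! Max J) y" "adjacent ?G z (fs ! Max J)"
      using graph_cycle_two_neighbours[OF cyc, of "fs ! Max J"] m by (auto simp: J_def)
    have "w = fs ! P (Max J)" if w: "w \<in> set xs" "adjacent ?G (fs ! Max J) w" for w
    proof -
      obtain j where j: "w = fs ! j" "j < ?n"
        using w(1) sub by (metis in_set_conv_nth subsetD)
      then have "j \<le> Max J" using w(1) max by (simp add: J_def)
      moreover have "(0 < Max J \<and> j = P (Max J)) \<or> (0 < j \<and> Max J = P j)"
        using adj w(2) j m by (simp add: J_def)
      ultimately show ?thesis using par[of j] j by auto
    qed
    then show False using yz adjacent_sym by metis
  qed
  ultimately show ?thesis unfolding is_tree_def using simple by blast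
qed

lemma parent_graph_in_trees:
  assumes "distinct fs" "parent_function (length fs) P"
  shows "parent_graph fs P \<in> trees (length fs)"
  using is_tree_parent_graph[OF assms] assms(1)
  by (simp add: trees_def parent_graph_def distinct_card)

lemma graph_isomorphic_parent_graph:
  assumes "distinct fs" "parent_function (length fs) P"
  shows "graph_isomorphic (parent_graph [0..<length fs] P) (parent_graph fs P)"
  unfolding graph_isomorphic_def
proof (intro exI conjI ballI)
  show "bij_betw ((!) fs) (verts (parent_graph [0..<length fs] P)) (verts (parent_graph fs P))"
    using bij_betw_nth[OF assms(1) refl refl] by (simp add: parent_graph_def atLeast0LessThan)
  fix u v assume "u \<in> verts (parent_graph [0..<length fs] P)" "v \<in> verts (parent_graph [0..<length fs] P)"
  then have uv: "u < length fs" "v < length fs" by (auto simp: parent_graph_def)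
  show "adjacent (parent_graph [0..<length fs] P) u v \<longleftrightarrow>
        adjacent (parent_graph fs P) (fs ! u) (fs ! v)"
    using adjacent_parent_graph_iff[OF assms uv]
      adjacent_parent_graph_iff[of "[0..<length fs]" P u v] assms uv by simp
qed

section \<open>Vertices and edges of the graph of trees\<close>

definition tree_class :: "nat \<Rightarrow> (nat \<Rightarrow> nat) \<Rightarrow> nat ugraph set" where
  "tree_class n P = tree_iso_rel n `` {parent_graph [0..<n] P}"

lemma tree_class_in_graph_of_trees:
  assumes "parent_function n P"
  shows "tree_class n P \<in> verts (graph_of_trees n)"
  using parent_graph_in_trees[of "[0..<n]" P] assms
  by (auto simp: tree_class_def graph_of_trees_def intro: quotientI)

lemma parent_graph_in_tree_class:
  assumes "distinct fs" "parent_function n P" "length fs = n"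
  shows "parent_graph fs P \<in> tree_class n P"
  using graph_isomorphic_parent_graph[of fs P] parent_graph_in_trees[of fs P]
    parent_graph_in_trees[of "[0..<n]" P] assms
  by (auto simp: tree_class_def tree_iso_rel_def)

lemma transposition_edge:
  fixes fs gs :: "nat list"
  assumes P: "parent_function n P" and Q: "parent_function n Q"
    and ne: "tree_class n P \<noteq> tree_class n Q"
    and fs: "distinct fs" "length fs = n" and gs: "distinct gs" "length gs = n"
    and s: "plane_rooted_version s (parent_graph fs P)"
    and t: "plane_rooted_version t (parent_graph gs Q)"
    and st: "transposition s t"
  shows "{tree_class n P, tree_class n Q} \<in> edges (graph_of_trees n)"
proof -
  have "tree_classes_adjacent (tree_class n P) (tree_class n Q)"
    unfolding tree_classes_adjacent_def
    using ne s t st parent_graph_in_tree_class[OF fs(1) P fs(2)]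
      parent_graph_in_tree_class[OF gs(1) Q gs(2)] by blast
  then show ?thesis
    using tree_class_in_graph_of_trees[OF P] tree_class_in_graph_of_trees[OF Q]
    by (auto simp: graph_of_trees_def)
qed

section \<open>An isomorphism invariant and its evaluation\<close>

text \<open>This is the adjacency operator applied to \<open>h\<close>: the constant weight 1 gives
  the degree, and a second application gives the sum of the degrees of the neighbours.\<close>

definition neighbour_sum :: "'a ugraph \<Rightarrow> ('a \<Rightarrow> nat) \<Rightarrow> 'a \<Rightarrow> nat" where
  "neighbour_sum G h v = (\<Sum>u | u \<in> verts G \<and> adjacent G v u. h u)"

text \<open>
  An isomorphism invariant, chosen because it takes different values on the nine trees below.
\<close>

definition tree_index :: "'a ugraph \<Rightarrow> nat" where
  "tree_index G = (\<Sum>v\<in>verts G. neighbour_sum G (\<lambda>_. 1) v *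
     (neighbour_sum G (neighbour_sum G (\<lambda>_. 1)) v)\<^sup>2)"

lemma tree_index_cong:
  assumes "graph_isomorphic G H"
  shows "tree_index G = tree_index H"
proof -
  obtain f where f: "bij_betw f (verts G) (verts H)"
    and adj: "\<And>u v. u \<in> verts G \<Longrightarrow> v \<in> verts G \<Longrightarrow> adjacent G u v \<longleftrightarrow> adjacent H (f u) (f v)"
    using assms unfolding graph_isomorphic_def by blast
  \<comment> \<open>The weights are left general so that the fact also applies to the nested sum,
    where the weight is itself a neighbour sum.\<close>
  have ns: "neighbour_sum G h v = neighbour_sum H h' (f v)"
    if v: "v \<in> verts G" and h: "\<And>u. u \<in> verts G \<Longrightarrow> h u = h' (f u)" for h h' v
  proof -
    have "bij_betw f {u \<in> verts G. adjacent G v u} {u \<in> verts H. adjacent H (f v) u}"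
      using f adj[OF v] by (intro bij_betw_Collect) auto
    from sum.reindex_bij_betw[OF this, of h'] show ?thesis
      unfolding neighbour_sum_def by (metis (mono_tags, lifting) h mem_Collect_eq sum.cong)
  qed
  show ?thesis
    unfolding tree_index_def sum.reindex_bij_betw[OF f, symmetric]
    by (intro sum.cong refl arg_cong2[of _ _ _ _ "\<lambda>a b. a * b\<^sup>2"] ns) auto
qed

text \<open>An executable form of the neighbourhood: first the parent, absent for the root, then the
  children. The search starts at 1 because the entry at 0 is no parent.\<close>

definition neighbour_list :: "nat \<Rightarrow> (nat \<Rightarrow> nat) \<Rightarrow> nat \<Rightarrow> nat list" where
  "neighbour_list n P v = (if v = 0 then [] else [P v]) @ filter (\<lambda>i. P i = v) [1..<n]"

lemma neighbour_sum_parent_graph: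
  assumes "parent_function n P" "v < n"
  shows "neighbour_sum (parent_graph [0..<n] P) h v = (\<Sum>u\<leftarrow>neighbour_list n P v. h u)"
proof -
  have par: "P i < i" if "0 < i" "i < n" for i
    using assms(1) that unfolding parent_function_def by auto
  have "P v < n" if "0 < v" using par[OF that assms(2)] assms(2) by simp
  then have "set (neighbour_list n P v) =
      {u \<in> verts (parent_graph [0..<n] P). adjacent (parent_graph [0..<n] P) v u}"
    using adjacent_parent_graph_iff[of "[0..<n]" P v] assms
    by (auto simp: neighbour_list_def parent_graph_def)
  \<comment> \<open>Parents decrease, so the parent of \<open>v\<close> does not occur again among
    the children of \<open>v\<close>.\<close>
  moreover have "P (P v) \<noteq> v" if "0 < P v" "0 < v"
    using par[of v] par[of "P v"] assms(2) that by auto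
  then have "distinct (neighbour_list n P v)"
    by (auto simp: neighbour_list_def)
  ultimately show ?thesis
    by (simp add: neighbour_sum_def sum_list_distinct_conv_sum_set)
qed

text \<open>This turns the invariant of a concrete tree into a sum over lists that can be
  evaluated.\<close>

lemma tree_index_parent_graph:
  assumes "parent_function n P"
  shows "tree_index (parent_graph [0..<n] P) =
    (\<Sum>v\<leftarrow>[0..<n]. length (neighbour_list n P v) *
       (\<Sum>u\<leftarrow>neighbour_list n P v. length (neighbour_list n P u))\<^sup>2)"
proof -
  let ?G = "parent_graph [0..<n] P"
  have "P v < n" if "0 < v" "v < n" for v
    using that assms unfolding parent_function_def
    by (metis One_nat_def Suc_leI atLeastLessThan_iff less_trans)
  then have lt: "u < n" if "u \<in> set (neighbour_list n P v)" "v < n" for u v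
    using that by (auto simp: neighbour_list_def split: if_splits)
  note ns = neighbour_sum_parent_graph[OF assms]
  have deg: "neighbour_sum ?G (\<lambda>_. 1) v = length (neighbour_list n P v)" if "v < n" for v
    using ns[OF that] by (simp add: sum_list_triv)
  have "neighbour_sum ?G (neighbour_sum ?G (\<lambda>_. 1)) v =
      (\<Sum>u\<leftarrow>neighbour_list n P v. length (neighbour_list n P u))" if "v < n" for v
    unfolding ns[OF that] using deg lt that by (intro arg_cong[of _ _ sum_list] map_cong) auto
  moreover have "verts ?G = set [0..<n]" by (simp add: parent_graph_def)
  ultimately show ?thesis
    unfolding tree_index_def using deg
    by (simp add: sum_list_distinct_conv_sum_set)
qed

section \<open>Nine trees with ten vertices\<close>

text \<open>Rooting the tree at \<open>A\<close> and ordering its neighbours suitably brings any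
  move of a leaf \<open>B\<close> along an edge from \<open>A\<close> to \<open>C\<close> into the
  form \<open>down\<close> at the root. The source keeps its own numbers as names; \<open>gs\<close>
  gives each vertex of the target its name in the source.\<close>

lemma leaf_move_edge:
  fixes A B C :: nat
  assumes "parent_function n P" "parent_function n Q" "tree_class n P \<noteq> tree_class n Q"
    and "distinct gs" "length gs = n"
    and "plane_rooted_version (Node A (Node B [] # Node C ts # rs)) (parent_graph [0..<n] P)"
    and "plane_rooted_version (Node A (Node C (Node B [] # ts) # rs)) (parent_graph gs Q)"
  shows "{tree_class n P, tree_class n Q} \<in> edges (graph_of_trees n)"
  using transposition_edge[OF assms(1-3) _ _ assms(4-7)] transposition.down[of A "[]" B C ts rs]
  by simp

text \<open>
  Entry \<open>i\<close> of a list is the parent of vertex \<open>i\<close>; entry \<open>0\<close> is a dummy. The nine trees, found by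
  computer search, are in the order required by \<open>not_planar_if_K33_subdivision\<close>.
\<close>

definition K33_parents :: "nat list list" where
  "K33_parents =
     [[0, 0, 1, 2, 3, 3, 2, 0, 7, 8],
      [0, 0, 1, 2, 3, 3, 0, 6, 7, 0],
      [0, 0, 1, 2, 2, 0, 5, 6, 6, 0],
      [0, 0, 1, 2, 3, 3, 1, 0, 7, 8],
      [0, 0, 1, 2, 2, 1, 0, 6, 7, 7],
      [0, 0, 1, 2, 3, 2, 1, 0, 7, 8],
      [0, 0, 1, 2, 3, 2, 2, 0, 7, 8],
      [0, 0, 1, 2, 3, 2, 0, 6, 7, 0],
      [0, 0, 1, 2, 2, 0, 5, 6, 5, 0]]"

definition K33_vertex :: "nat \<Rightarrow> nat ugraph set" where
  "K33_vertex i = tree_class 10 ((!) (K33_parents ! i))"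

lemma parent_function_K33_parents:
  assumes "i < 9"
  shows "parent_function 10 ((!) (K33_parents ! i))"
proof -
  have "\<forall>p\<in>set K33_parents. \<forall>i\<in>set [1..<10]. p ! i < i"
    by code_simp
  moreover have "K33_parents ! i \<in> set K33_parents"
    using assms by (intro nth_mem) (simp add: K33_parents_def)
  ultimately show ?thesis by (simp add: parent_function_def)
qed

text \<open>Equal classes have isomorphic representatives, hence the same tree index; evaluation
  shows that the nine indices are distinct.\<close>

lemma inj_on_K33_vertex: "inj_on K33_vertex {..<9}"
proof (rule inj_onI)
  fix i j :: nat assume ij: "i \<in> {..<9}" "j \<in> {..<9}" and eq: "K33_vertex i = K33_vertex j"
  define T where "T = (\<lambda>i. parent_graph [0..<10] ((!) (K33_parents ! i)))"
  define ind where "ind = (\<lambda>P. \<Sum>v\<leftarrow>[0..<10]. length (neighbour_list 10 P v) *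
    (\<Sum>u\<leftarrow>neighbour_list 10 P v. length (neighbour_list 10 P u))\<^sup>2)"
  have par: "parent_function 10 ((!) (K33_parents ! i))" "parent_function 10 ((!) (K33_parents ! j))"
    using ij parent_function_K33_parents by auto
  then have "T j \<in> K33_vertex i"
    using parent_graph_in_tree_class[of "[0..<10]" 10] unfolding eq by (simp add: T_def K33_vertex_def)
  then have "graph_isomorphic (T i) (T j)"
    by (simp add: K33_vertex_def tree_class_def tree_iso_rel_def T_def)
  then have "ind ((!) (K33_parents ! i)) = ind ((!) (K33_parents ! j))"
    using tree_index_cong[of "T i" "T j"] par by (simp add: T_def ind_def tree_index_parent_graph)
  moreover have "distinct (map (\<lambda>p. ind ((!) p)) K33_parents)"
    unfolding ind_def by code_simp
  moreover have "length K33_parents = 9" by (simp add: K33_parents_def)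
  ultimately show "i = j"
    using ij by (auto simp: distinct_conv_nth)
qed

text \<open>The conditions on the trees form a single conjunction, which evaluation decides for
  concrete witnesses. That the two classes differ follows from
  \<open>inj_on_K33_vertex\<close>.\<close>

lemma K33_leaf_move_edge:
  fixes A B C :: nat
  assumes "i < 9" "j < 9" "i \<noteq> j"
    and "distinct gs \<and> length gs = 10 \<and>
      plane_rooted_version (Node A (Node B [] # Node C ts # rs))
        (parent_graph [0..<10] ((!) (K33_parents ! i))) \<and>
      plane_rooted_version (Node A (Node C (Node B [] # ts) # rs))
        (parent_graph gs ((!) (K33_parents ! j)))"
  shows "{K33_vertex i, K33_vertex j} \<in> edges (graph_of_trees 10)"
  unfolding K33_vertex_def
  using assms inj_onD[OF inj_on_K33_vertex, of i j] unfolding K33_vertex_def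
  by (intro leaf_move_edge[of _ _ _ gs A B C ts rs] parent_function_K33_parents) auto

text \<open>In each case the tree of the first index is rerooted at \<open>A\<close>, and its leaf
  \<open>B\<close> moves to \<open>C\<close>. The list \<open>gs\<close> matches the result with the
  listed parents of the second tree; entry \<open>k\<close> is the name of the vertex that plays the
  role of \<open>k\<close> there.\<close>

lemma K33_edges:
  shows "{K33_vertex 0, K33_vertex 3} \<in> edges (graph_of_trees 10)"
    and "{K33_vertex 1, K33_vertex 3} \<in> edges (graph_of_trees 10)"
    and "{K33_vertex 2, K33_vertex 3} \<in> edges (graph_of_trees 10)"
    and "{K33_vertex 0, K33_vertex 4} \<in> edges (graph_of_trees 10)"
    and "{K33_vertex 1, K33_vertex 4} \<in> edges (graph_of_trees 10)"
    and "{K33_vertex 2, K33_vertex 4} \<in> edges (graph_of_trees 10)"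
    and "{K33_vertex 0, K33_vertex 6} \<in> edges (graph_of_trees 10)"
    and "{K33_vertex 1, K33_vertex 7} \<in> edges (graph_of_trees 10)"
    and "{K33_vertex 2, K33_vertex 8} \<in> edges (graph_of_trees 10)"
    and "{K33_vertex 6, K33_vertex 5} \<in> edges (graph_of_trees 10)"
    and "{K33_vertex 7, K33_vertex 5} \<in> edges (graph_of_trees 10)"
    and "{K33_vertex 8, K33_vertex 5} \<in> edges (graph_of_trees 10)"
proof -
  show "{K33_vertex 0, K33_vertex 3} \<in> edges (graph_of_trees 10)"
    by (rule K33_leaf_move_edge[where A = 2 and B = 6 and C = 1
          and ts = "[Node 0 [Node 7 [Node 8 [Node 9 []]]]]"
          and rs = "[Node 3 [Node 4 [], Node 5 []]]"
          and gs = "[0, 1, 2, 3, 4, 5, 6, 7, 8, 9]"]; code_simp)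
  show "{K33_vertex 1, K33_vertex 3} \<in> edges (graph_of_trees 10)"
    by (rule K33_leaf_move_edge[where A = 0 and B = 9 and C = 1
          and ts = "[Node 2 [Node 3 [Node 4 [], Node 5 []]]]"
          and rs = "[Node 6 [Node 7 [Node 8 []]]]"
          and gs = "[0, 1, 2, 3, 4, 5, 9, 6, 7, 8]"]; code_simp)
  show "{K33_vertex 2, K33_vertex 3} \<in> edges (graph_of_trees 10)"
    \<comment> \<open>Here \<open>C\<close> is itself a leaf: two leaves at \<open>A\<close> become
      a path of two edges. The second tree has its root at the vertex named 1, so \<open>gs\<close>
      renames substantially.\<close>
    by (rule K33_leaf_move_edge[where A = 2 and B = 3 and C = 4
          and ts = "[]"
          and rs = "[Node 1 [Node 0 [Node 5 [Node 6 [Node 7 [], Node 8 []]], Node 9 []]]]"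
          and gs = "[1, 0, 5, 6, 7, 8, 9, 2, 4, 3]"]; code_simp)
  show "{K33_vertex 0, K33_vertex 4} \<in> edges (graph_of_trees 10)"
    by (rule K33_leaf_move_edge[where A = 8 and B = 9 and C = 7
          and ts = "[Node 0 [Node 1 [Node 2 [Node 3 [Node 4 [], Node 5 []], Node 6 []]]]]"
          and rs = "[]"
          and gs = "[1, 2, 3, 4, 5, 6, 0, 7, 8, 9]"]; code_simp)
  show "{K33_vertex 1, K33_vertex 4} \<in> edges (graph_of_trees 10)"
    by (rule K33_leaf_move_edge[where A = 7 and B = 8 and C = 6
          and ts = "[Node 0 [Node 1 [Node 2 [Node 3 [Node 4 [], Node 5 []]]], Node 9 []]]"
          and rs = "[]"
          and gs = "[1, 0, 6, 7, 8, 9, 2, 3, 4, 5]"]; code_simp)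
  show "{K33_vertex 2, K33_vertex 4} \<in> edges (graph_of_trees 10)"
    by (rule K33_leaf_move_edge[where A = 0 and B = 9 and C = 1
          and ts = "[Node 2 [Node 3 [], Node 4 []]]"
          and rs = "[Node 5 [Node 6 [Node 7 [], Node 8 []]]]"
          and gs = "[0, 1, 2, 3, 4, 9, 5, 6, 7, 8]"]; code_simp)
  show "{K33_vertex 0, K33_vertex 6} \<in> edges (graph_of_trees 10)"
    by (rule K33_leaf_move_edge[where A = 3 and B = 4 and C = 2
          and ts = "[Node 1 [Node 0 [Node 7 [Node 8 [Node 9 []]]]], Node 6 []]"
          and rs = "[Node 5 []]"
          and gs = "[0, 1, 2, 3, 5, 6, 4, 7, 8, 9]"]; code_simp)
  show "{K33_vertex 1, K33_vertex 7} \<in> edges (graph_of_trees 10)"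
    by (rule K33_leaf_move_edge[where A = 3 and B = 4 and C = 2
          and ts = "[Node 1 [Node 0 [Node 6 [Node 7 [Node 8 []]], Node 9 []]]]"
          and rs = "[Node 5 []]"
          and gs = "[0, 1, 2, 3, 5, 4, 6, 7, 8, 9]"]; code_simp)
  show "{K33_vertex 2, K33_vertex 8} \<in> edges (graph_of_trees 10)"
    by (rule K33_leaf_move_edge[where A = 2 and B = 3 and C = 1
          and ts = "[Node 0 [Node 5 [Node 6 [Node 7 [], Node 8 []]], Node 9 []]]"
          and rs = "[Node 4 []]"
          and gs = "[0, 5, 6, 7, 8, 1, 2, 4, 3, 9]"]; code_simp)
  show "{K33_vertex 6, K33_vertex 5} \<in> edges (graph_of_trees 10)"
    by (rule K33_leaf_move_edge[where A = 2 and B = 5 and C = 1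
          and ts = "[Node 0 [Node 7 [Node 8 [Node 9 []]]]]"
          and rs = "[Node 3 [Node 4 []], Node 6 []]"
          and gs = "[0, 1, 2, 3, 4, 6, 5, 7, 8, 9]"]; code_simp)
  show "{K33_vertex 7, K33_vertex 5} \<in> edges (graph_of_trees 10)"
    by (rule K33_leaf_move_edge[where A = 0 and B = 9 and C = 1
          and ts = "[Node 2 [Node 3 [Node 4 []], Node 5 []]]"
          and rs = "[Node 6 [Node 7 [Node 8 []]]]"
          and gs = "[0, 1, 2, 3, 4, 5, 9, 6, 7, 8]"]; code_simp)
  show "{K33_vertex 8, K33_vertex 5} \<in> edges (graph_of_trees 10)"
    by (rule K33_leaf_move_edge[where A = 2 and B = 3 and C = 4
          and ts = "[]"
          and rs = "[Node 1 [Node 0 [Node 5 [Node 6 [Node 7 []], Node 8 []], Node 9 []]]]"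
          and gs = "[1, 0, 5, 6, 7, 8, 9, 2, 4, 3]"]; code_simp)
qed

theorem mainTheorem9:
  shows "\<not> planar (graph_of_trees 10)"
proof (rule not_planar_if_K33_subdivision)
  show "inj_on K33_vertex {..<9}" by (rule inj_on_K33_vertex)
  show "K33_vertex ` {..<9} \<subseteq> verts (graph_of_trees 10)"
    using tree_class_in_graph_of_trees parent_function_K33_parents by (auto simp: K33_vertex_def)
  fix i :: nat assume "i < 3"
  then consider "i = 0" | "i = 1" | "i = 2" by linarith
  note cases = this
  show "{K33_vertex i, K33_vertex 3} \<in> edges (graph_of_trees 10)"
    "{K33_vertex i, K33_vertex 4} \<in> edges (graph_of_trees 10)"
    "{K33_vertex i, K33_vertex (6 + i)} \<in> edges (graph_of_trees 10)"
    "{K33_vertex (6 + i), K33_vertex 5} \<in> edges (graph_of_trees 10)"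
    using K33_edges by (cases rule: cases; simp)+
qed

end
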